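(* For any integer $n\ge 1$, there exists a $(2^n-1,n,p)$-RAC such that $$p\ge \frac12+\frac{1}{2(2^{n+1}-5)} .$$
   Context: An $(m,n,p)$-RAC (classical random access coding) is an encoding of $m$ bits into $n$ bits such that any one of the $m$ bits can be recovered with probability at least $p$: for each $x\in\{0,1\}^m$ there is a probability distribution $q_x$ on $\{0,1\}^n$ (randomized encoding), and for each $i\in\{1,\dots,m\}$ and $s\in\{0,1\}^n$ a probability $l_i(s)\in[0,1]$ of outputting $0$ on codeword $s$ (randomized decoding), such that for all $x$ and $i$ the output equals $x_i$ with probability at least $p$ (output $0$ has probability $\sum_s q_x(s)l_i(s)$). No randomness is shared between encoder and decoder. *)

theory Defs
  imports "HOL-Probability.Probability_Mass_Function"
begin

text \<open>Bit strings are lists of Booleans, with \<open>False\<close> for the bit 0 and \<open>True\<close> for the bit 1;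
  positions are numbered from 0, so the \<open>m\<close> positions are the \<open>i < m\<close>.\<close>

definition bitstrings :: "nat \<Rightarrow> bool list set" where
  "bitstrings n = {s. length s = n}"

text \<open>\<open>l i s\<close> is the probability that the decoder asked for bit \<open>i\<close> outputs 0 on codeword \<open>s\<close>,
  hence it outputs 1 with probability \<open>1 - l i s\<close>.\<close>

definition output_prob ::
    "nat \<Rightarrow> (bool list \<Rightarrow> bool list pmf) \<Rightarrow> (nat \<Rightarrow> bool list \<Rightarrow> real)
      \<Rightarrow> bool list \<Rightarrow> nat \<Rightarrow> bool \<Rightarrow> real" where
  "output_prob n q l x i b =
    (\<Sum>s\<in>bitstrings n. pmf (q x) s * (if b then 1 - l i s else l i s))"

definition is_RAC ::
    "nat \<Rightarrow> nat \<Rightarrow> real \<Rightarrow> (bool list \<Rightarrow> bool list pmf) \<Rightarrow> (nat \<Rightarrow> bool list \<Rightarrow> real) \<Rightarrow> bool" where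
  "is_RAC m n p q l \<longleftrightarrow>
    (\<forall>x\<in>bitstrings m. set_pmf (q x) \<subseteq> bitstrings n) \<and>
    (\<forall>i<m. \<forall>s\<in>bitstrings n. l i s \<in> {0..1}) \<and>
    (\<forall>x\<in>bitstrings m. \<forall>i<m. output_prob n q l x i (x ! i) \<ge> p)"

end

(* Decode with the nontrivial Walsh characters chi_i of the group of codewords: the decoder asked for
   bit i outputs 0 exactly when chi_i(s) = 1. As vectors of character values, the 2^n codewords are
   the vertices of a simplex in dimension m = 2^n - 1 which contains the cube [-1/m, 1/m]^m: by
   orthogonality of characters, the point y has barycentric coordinates
   (1 + sum_i y_i chi_i(s)) / 2^n, and these are nonnegative when |y_i| <= 1/m. Encoding x as the
   corner of that cube with signs given by x yields success probability 1/2 + 1/(2m), which is at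
   least the claimed bound. *)

theory Submission
  imports Defs
begin

text \<open>The character (-1)^(t . s) of the group (Z/2)^n, with \<open>t\<close> as its index. For
  lists of equal length the catch-all equation is reached only at the empty lists, where it is the
  empty product.\<close>

fun walsh :: "bool list \<Rightarrow> bool list \<Rightarrow> real" where
  "walsh (a # t) (b # s) = (if a \<and> b then - 1 else 1) * walsh t s"
| "walsh _ _ = 1"

lemma abs_walsh [simp]: "\<bar>walsh t s\<bar> = 1"
  by (induction t s rule: walsh.induct) (auto simp: abs_mult)

lemma walsh_replicate_False [simp]: "walsh (replicate k False) s = 1"
proof (induction k arbitrary: s)
  case (Suc k)
  then show ?case by (cases s) auto
qed simp

lemma bitstrings_0: "bitstrings 0 = {[]}"
  by (auto simp: bitstrings_def)

lemma bitstrings_Suc: "bitstrings (Suc n) = Cons False ` bitstrings n \<union> Cons True ` bitstrings n"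
  by (auto simp: bitstrings_def length_Suc_conv)

lemma bitstrings_eq_lists: "bitstrings n = {s. set s \<subseteq> UNIV \<and> length s = n}"
  by (simp add: bitstrings_def)

lemma finite_bitstrings [simp]: "finite (bitstrings n)"
  unfolding bitstrings_eq_lists by (rule finite_lists_length_eq) simp

lemma card_bitstrings: "card (bitstrings n) = 2 ^ n"
  unfolding bitstrings_eq_lists by (subst card_lists_length_eq) simp_all

lemma sum_bitstrings_Suc:
  "(\<Sum>s\<in>bitstrings (Suc n). f s) =
    (\<Sum>s\<in>bitstrings n. f (False # s)) + (\<Sum>s\<in>bitstrings n. f (True # s))"
  unfolding bitstrings_Suc
  by (subst sum.union_disjoint) (auto simp: sum.reindex)

text \<open>Splitting on the first bit of \<open>s\<close> gives two copies of the sum for the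
  tails: they add up if the heads of \<open>t\<close> and \<open>u\<close> agree and cancel
  otherwise.\<close>

lemma sum_walsh_mult_walsh:
  assumes "length t = n" "length u = n"
  shows "(\<Sum>s\<in>bitstrings n. walsh t s * walsh u s) = (if t = u then 2 ^ n else 0)"
  using assms
proof (induction n arbitrary: t u)
  case 0
  then show ?case by (simp add: bitstrings_0)
next
  case (Suc n)
  then obtain a t' b u' where [simp]: "t = a # t'" "u = b # u'"
    and "length t' = n" "length u' = n"
    by (auto simp: length_Suc_conv)
  with Suc.IH[of t' u'] show ?case
    by (auto simp: sum_bitstrings_Suc sum_negf)
qed

text \<open>Orthogonality to the trivial character, whose index is the all-\<open>False\<close>
  list.\<close>

lemma sum_walsh:
  assumes "length t = n" "t \<noteq> replicate n False"
  shows "(\<Sum>s\<in>bitstrings n. walsh t s) = 0"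
  using sum_walsh_mult_walsh[of t n "replicate n False"] assms by simp

lemma exists_pmf_of_weights:
  fixes w :: "'a \<Rightarrow> real"
  assumes "finite A" "\<And>s. s \<in> A \<Longrightarrow> 0 \<le> w s" "sum w A = 1"
  shows "\<exists>q. set_pmf q \<subseteq> A \<and> (\<forall>s\<in>A. pmf q s = w s)"
proof -
  \<comment> \<open>\<open>embed_pmf\<close> expects weights on the whole type, hence the extension
    by 0.\<close>
  define f where "f s = (if s \<in> A then w s else 0)" for s
  have "(\<integral>\<^sup>+s. ennreal (f s) \<partial>count_space UNIV) = (\<Sum>s\<in>A. ennreal (f s))"
    using assms(1) by (intro nn_integral_count_space') (auto simp: f_def)
  also have "\<dots> = ennreal (\<Sum>s\<in>A. f s)"
    using assms(2) by (intro sum_ennreal) (auto simp: f_def)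
  also have "(\<Sum>s\<in>A. f s) = 1"
    using assms(3) by (simp add: f_def)
  finally have "pmf (embed_pmf f) s = f s" for s
    using assms(2) by (intro pmf_embed_pmf) (auto simp: f_def)
  then show ?thesis
    by (intro exI[of _ "embed_pmf f"]) (auto simp: set_pmf_iff f_def split: if_splits)
qed

theorem simplex_RAC:
  assumes "n \<ge> 1"
  shows "\<exists>q l. is_RAC (2 ^ n - 1) n (1 / 2 + 1 / (2 * (2 ^ n - 1))) q l"
proof -
  define m :: nat where "m = 2 ^ n - 1"
  have "(2::nat) ^ n \<ge> 2 ^ 1"
    using assms by (intro power_increasing) auto
  then have "m > 0" and real_m: "real m = 2 ^ n - 1"
    by (auto simp: m_def of_nat_diff)
  define Z where "Z = replicate n False"
  have "Z \<in> bitstrings n"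
    by (simp add: Z_def bitstrings_def)
  then have "card (bitstrings n - {Z}) = m"
    by (simp add: m_def card_bitstrings)
  \<comment> \<open>Each bit position gets its own nontrivial character; removing the trivial index
    \<open>Z\<close> leaves exactly \<open>m\<close> of them.\<close>
  then obtain e where e: "bij_betw e {..<m} (bitstrings n - {Z})"
    using ex_bij_betw_nat_finite[of "bitstrings n - {Z}"] by (auto simp: atLeast0LessThan)
  then have e_mem: "length (e i) = n \<and> e i \<noteq> Z" if "i < m" for i
    using that by (auto simp: bij_betw_def bitstrings_def)
  have sum_e: "(\<Sum>s\<in>bitstrings n. walsh (e i) s) = 0" if "i < m" for i
    using e_mem[OF that] by (intro sum_walsh) (auto simp: Z_def)
  have sum_ee: "(\<Sum>s\<in>bitstrings n. walsh (e i) s * walsh (e j) s) = (if i = j then 2 ^ n else 0)"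
    if "i < m" "j < m" for i j
    using that e e_mem sum_walsh_mult_walsh[of "e i" n "e j"]
    by (auto simp: bij_betw_def inj_on_def)
  \<comment> \<open>The corner of the cube for \<open>x\<close>: bit 0 has the positive sign,
    because the decoder answers 0 where the character is 1.\<close>
  define y where "y x i = (if x ! i then - 1 else 1) / real m" for x i
  \<comment> \<open>Fourier inversion: the function with coefficient 1 at the trivial character and
    \<open>y x i\<close> at \<open>e i\<close>.\<close>
  define w where "w x s = (1 + (\<Sum>i<m. y x i * walsh (e i) s)) / 2 ^ n" for x s
  \<comment> \<open>The \<open>m\<close> terms have absolute value 1/m each, so their sum is at
    least -1.\<close>
  have w_nonneg: "0 \<le> w x s" for x s
  proof -
    have "\<bar>\<Sum>i<m. y x i * walsh (e i) s\<bar> \<le> (\<Sum>i<m. \<bar>y x i * walsh (e i) s\<bar>)"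
      by (rule sum_abs)
    also have "\<dots> = (\<Sum>i<m. 1 / real m)"
      by (intro sum.cong) (auto simp: y_def abs_mult)
    also have "\<dots> = 1"
      using \<open>m > 0\<close> by simp
    finally show ?thesis
      by (simp add: w_def)
  qed
  have sum_w: "(\<Sum>s\<in>bitstrings n. w x s) = 1" for x
  proof -
    have "(\<Sum>s\<in>bitstrings n. \<Sum>i<m. y x i * walsh (e i) s)
        = (\<Sum>i<m. y x i * (\<Sum>s\<in>bitstrings n. walsh (e i) s))"
      by (subst sum.swap) (simp add: sum_distrib_left)
    also have "\<dots> = 0"
      by (simp add: sum_e)
    finally show ?thesis
      by (simp add: w_def sum.distrib card_bitstrings flip: sum_divide_distrib)
  qed
  \<comment> \<open>The mean of the \<open>j\<close>-th character under the weights: by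
    orthogonality only the term \<open>i = j\<close> survives.\<close>
  have sum_w_walsh: "(\<Sum>s\<in>bitstrings n. w x s * walsh (e j) s) = y x j" if "j < m" for x j
  proof -
    have "(\<Sum>s\<in>bitstrings n. w x s * walsh (e j) s)
        = (\<Sum>s\<in>bitstrings n. walsh (e j) s + (\<Sum>i<m. y x i * (walsh (e i) s * walsh (e j) s)))
            / 2 ^ n"
      by (simp add: w_def sum_divide_distrib sum_distrib_right distrib_right mult.assoc)
    also have "\<dots> = (\<Sum>i<m. y x i * (\<Sum>s\<in>bitstrings n. walsh (e i) s * walsh (e j) s)) / 2 ^ n"
      by (simp add: sum.distrib sum_e that sum_distrib_left sum.swap[of _ "{..<m}"])
    also have "\<dots> = (\<Sum>i<m. if i = j then y x i * 2 ^ n else 0) / 2 ^ n"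
      using that by (intro arg_cong2[where f = "(/)"] sum.cong) (auto simp: sum_ee)
    also have "\<dots> = y x j"
      using that by simp
    finally show ?thesis .
  qed
  have "\<exists>q. set_pmf q \<subseteq> bitstrings n \<and> (\<forall>s\<in>bitstrings n. pmf q s = w x s)" for x
    using w_nonneg sum_w by (intro exists_pmf_of_weights) auto
  then obtain q where q: "set_pmf (q x) \<subseteq> bitstrings n" 
    "\<And>s. s \<in> bitstrings n \<Longrightarrow> pmf (q x) s = w x s" for x
    by metis
  define l where "l i s = (1 + walsh (e i) s) / 2" for i s
  have l_range: "l i s \<in> {0..1}" for i s
    using abs_walsh[of "e i" s] by (auto simp: l_def abs_if split: if_splits)
  have "output_prob n q l x i (x ! i) = 1 / 2 + 1 / (2 * real m)" if "i < m" for x i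
  proof -
    \<comment> \<open>The probability is computed for an arbitrary answer \<open>b\<close>; at
      \<open>b = x ! i\<close> its sign cancels the one in \<open>y x i\<close>, leaving
      1/m.\<close>
    have "output_prob n q l x i b = (1 + (if b then - 1 else 1) * y x i) / 2" for b
    proof -
      have "output_prob n q l x i b
          = (\<Sum>s\<in>bitstrings n. (w x s + (if b then - 1 else 1) * (w x s * walsh (e i) s)) / 2)"
        unfolding output_prob_def
        by (intro sum.cong) (auto simp: q l_def field_simps)
      also have "\<dots> = (1 + (if b then - 1 else 1) * y x i) / 2"
        using that by (simp add: sum.distrib sum_w sum_w_walsh sum_negf sum_subtractf
            flip: sum_divide_distrib sum_distrib_left)
      finally show ?thesis .
    qed
    then show ?thesis
      by (simp add: y_def field_simps)
  qed
  then have "is_RAC m n (1 / 2 + 1 / (2 * real m)) q l"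
    using q(1) l_range by (auto simp: is_RAC_def)
  then show ?thesis
    unfolding real_m unfolding m_def by blast
qed

theorem theorem5p5:
  fixes n :: nat
  assumes "n \<ge> 1"
  shows "\<exists>(p::real) q l. is_RAC (2 ^ n - 1) n p q l \<and> p \<ge> 1 / 2 + 1 / (2 * (2 ^ (n + 1) - 5))"
proof -
  have "1 / (2 * (2 ^ (n + 1) - 5)) \<le> 1 / (2 * (2 ^ n - 1 :: real))"
  \<comment> \<open>For \<open>n = 1\<close> the denominator on the left is negative, so the left
    side is too. For larger \<open>n\<close> the denominators compare because 2^n \<ge> 4.\<close>
  proof (cases "n = 1")
    case False
    then have "(2::real) ^ n \<ge> 2 ^ 2"
      using assms by (intro power_increasing) auto
    then show ?thesis
      by (intro divide_left_mono) auto
  qed simp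
  then show ?thesis
    using simplex_RAC[OF assms] by (metis add_left_mono)
qed

end
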